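(* (Perron's formula.) Fix an irrational point $P\in\mathscr{Q}$ with digit expansion $P=[d_1,d_2,\dots,d_k,d_{k+1},\dots]_{\mathscr{Q}}$. For $k\ge1$ let $P_k'=[d_{k+1},d_{k+2},\dots]_{\mathscr{Q}}$ and $P_k''=[d_k,d_{k-1},\dots,d_2,d_1,3,3,3,\dots]_{\mathscr{Q}}$. Then for all sufficiently large $k$, \[ \delta(P;Z_k^{(0,1)}(P))=\frac{\sqrt2}{\|P_k'\|+\|P_k''\|}\cdot\epsilon_k(P),\qquad\text{where }\ \epsilon_k(P)=\frac{\sin(\theta(P)/2)}{\sin(\theta(Z_k^{(0,1)}(P))/2)}, \] and $\epsilon_k(P)\to1$ as $k\to\infty$.
   Context: $\mathscr{Q}=\{(x,y)\in\mathbb{R}^2: x^2+y^2=1,\ x,y\ge0\}$; irrational means not in $\mathbb{Q}^2$. Romik's map is $\mathcal{T}(x,y)=\left(\frac{|2-x-2y|}{3-2x-2y},\frac{|2-2x-y|}{3-2x-2y}\right)$; the digit of $(x,y)$ is $1$ if $4/5\le x\le1$, $2$ if $3/5\le x\le4/5$, $3$ if $0\le x\le3/5$ (the points $(4/5,3/5)$, $(3/5,4/5)$ admit both adjacent digits). A digit expansion $[d_1,d_2,\dots]_{\mathscr{Q}}$ of a point is a sequence with $d_j$ a valid digit of $\mathcal{T}^{j-1}$ of the point; every sequence in $\{1,2,3\}^{\mathbb{N}}$ is the expansion of exactly one point of $\mathscr{Q}$ (e.g. $[3,3,\dots]=(0,1)$). With $M_1=\begin{pmatrix}-1&2&2\\-2&1&2\\-2&2&3\end{pmatrix}$,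 $M_2=\begin{pmatrix}1&2&2\\2&1&2\\2&2&3\end{pmatrix}$, $M_3=\begin{pmatrix}1&-2&2\\2&-1&2\\2&-2&3\end{pmatrix}$, $Z_k^{(0,1)}(P)$ is the point $(a/c,b/c)$ where $(a,b,c)^T=M_{d_1}\cdots M_{d_k}(0,1,1)^T$. For rational $Z=(a/c,b/c)$ with integers $c>0$, $\gcd(a,b,c)=1$: $\mathrm{Ht}(Z)=c$ and $\delta(P;Z)=\mathrm{Ht}(Z)\cdot|P-Z|$ (Euclidean distance). For a point $X=(\alpha,\beta)$ on the unit circle, $\theta(X)\in[0,2\pi)$ is defined by $\alpha=\sin\theta(X)$, $\beta=\cos\theta(X)$. For $X=(\alpha,\beta)\in\mathscr{Q}$, $\|X\|=\frac1{\sqrt2}\left(\cot\frac{\theta(X)}2-1\right)=\frac{1+\beta-\alpha}{\sqrt2\,\alpha}\in[0,\infty]$. *)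

theory Defs
  imports "HOL-Analysis.Analysis"
begin

definition quarter_circle :: "(real \<times> real) set" where
  "quarter_circle = {(x, y). x\<^sup>2 + y\<^sup>2 = 1 \<and> x \<ge> 0 \<and> y \<ge> 0}"

definition romik_map :: "real \<times> real \<Rightarrow> real \<times> real" where
  "romik_map = (\<lambda>(x, y).
     (\<bar>2 - x - 2 * y\<bar> / (3 - 2 * x - 2 * y), \<bar>2 - 2 * x - y\<bar> / (3 - 2 * x - 2 * y)))"

datatype digit = D1 | D2 | D3

text \<open>The closed ranges overlap: (4/5, 3/5) and (3/5, 4/5) each have two valid digits.\<close>

fun valid_digit :: "digit \<Rightarrow> real \<times> real \<Rightarrow> bool" where
  "valid_digit D1 (x, y) \<longleftrightarrow> 4 / 5 \<le> x \<and> x \<le> 1"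
| "valid_digit D2 (x, y) \<longleftrightarrow> 3 / 5 \<le> x \<and> x \<le> 4 / 5"
| "valid_digit D3 (x, y) \<longleftrightarrow> 0 \<le> x \<and> x \<le> 3 / 5"

text \<open>Digit sequences are indexed from 0 here: \<open>d j\<close> is the digit $d_{j+1}$ of the usual
  1-based notation $[d_1, d_2, \dots]$.\<close>

definition is_expansion :: "(nat \<Rightarrow> digit) \<Rightarrow> real \<times> real \<Rightarrow> bool" where
  "is_expansion d X \<longleftrightarrow>
     X \<in> quarter_circle \<and> (\<forall>j. valid_digit (d j) ((romik_map ^^ j) X))"

text \<open>The point $[d_1, d_2, \dots]$; every digit sequence is the expansion of exactly one point.\<close>

definition point_of :: "(nat \<Rightarrow> digit) \<Rightarrow> real \<times> real" where
  "point_of d = (THE X. is_expansion d X)"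

text \<open>For a digit sequence \<open>d\<close>, \<open>tail_point d k\<close> is $P_k' = [d_{k+1}, d_{k+2}, \dots]$ and
  \<open>reversed_point d k\<close> is $P_k'' = [d_k, \dots, d_1, 3, 3, \dots]$.\<close>

definition tail_point :: "(nat \<Rightarrow> digit) \<Rightarrow> nat \<Rightarrow> real \<times> real" where
  "tail_point d k = point_of (\<lambda>j. d (k + j))"

definition reversed_point :: "(nat \<Rightarrow> digit) \<Rightarrow> nat \<Rightarrow> real \<times> real" where
  "reversed_point d k = point_of (\<lambda>j. if j < k then d (k - 1 - j) else D3)"

fun digit_matrix :: "digit \<Rightarrow> int^3^3" where
  "digit_matrix D1 = vector [vector [-1, 2, 2], vector [-2, 1, 2], vector [-2, 2, 3]]"
| "digit_matrix D2 = vector [vector [1, 2, 2], vector [2, 1, 2], vector [2, 2, 3]]"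
| "digit_matrix D3 = vector [vector [1, -2, 2], vector [2, -1, 2], vector [2, -2, 3]]"

primrec digit_matrix_prod :: "(nat \<Rightarrow> digit) \<Rightarrow> nat \<Rightarrow> int^3^3" where
  "digit_matrix_prod d 0 = mat 1"
| "digit_matrix_prod d (Suc k) = digit_matrix_prod d k ** digit_matrix (d k)"

text \<open>The rational approximation $Z_k^{(0,1)}$ determined by the first \<open>k\<close> digits.\<close>

definition convergent01 :: "(nat \<Rightarrow> digit) \<Rightarrow> nat \<Rightarrow> real \<times> real" where
  "convergent01 d k =
     (let v = digit_matrix_prod d k *v vector [0, 1, 1]
      in (real_of_int (v $ 1) / real_of_int (v $ 3), real_of_int (v $ 2) / real_of_int (v $ 3)))"

definition rat_height :: "real \<times> real \<Rightarrow> int" where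
  "rat_height Z = (THE c. c > 0 \<and> (\<exists>a b. Gcd {a, b, c} = 1 \<and>
     Z = (real_of_int a / real_of_int c, real_of_int b / real_of_int c)))"

text \<open>\<open>dist\<close> on pairs of reals is the Euclidean distance.\<close>

definition approx_delta :: "real \<times> real \<Rightarrow> real \<times> real \<Rightarrow> real" where
  "approx_delta P Z = real_of_int (rat_height Z) * dist P Z"

text \<open>The angle is measured from the positive second coordinate axis, so (0, 1) has angle 0.\<close>

definition circle_angle :: "real \<times> real \<Rightarrow> real" where
  "circle_angle X = (THE t. 0 \<le> t \<and> t < 2 * pi \<and> fst X = sin t \<and> snd X = cos t)"

text \<open>The case distinction is needed because \<open>cot 0 = 0\<close> in the library.\<close>

definition circle_norm :: "real \<times> real \<Rightarrow> ereal" where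
  "circle_norm X =
     (if circle_angle X = 0 then \<infinity> else ereal (1 / sqrt 2 * (cot (circle_angle X / 2) - 1)))"

definition perron_eps :: "real \<times> real \<Rightarrow> (nat \<Rightarrow> digit) \<Rightarrow> nat \<Rightarrow> real" where
  "perron_eps P d k = sin (circle_angle P / 2) / sin (circle_angle (convergent01 d k) / 2)"

lemma circle_angle_sin_cos:
  assumes "0 \<le> t" "t < 2 * pi"
  shows "circle_angle (sin t, cos t) = t"
  unfolding circle_angle_def fst_conv snd_conv
proof (rule the_equality)
  fix s assume s: "0 \<le> s \<and> s < 2 * pi \<and> sin t = sin s \<and> cos t = cos s"
  then obtain n where n: "s = t + 2 * pi * of_int n"
    using sin_cos_eq_iff[of s t] by auto
  have "2 * pi * real_of_int n < 2 * pi * 1" "2 * pi * (-1) < 2 * pi * real_of_int n"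
    using s assms n by linarith+
  then have "real_of_int n < 1" "-1 < real_of_int n"
    by (metis mult_less_cancel_left_pos pi_gt_zero zero_less_mult_iff zero_less_numeral)+
  then have "n = 0" by linarith
  then show "s = t" using n by simp
qed (use assms in auto)

lemma circle_norm_eq:
  assumes "(\<alpha>, \<beta>) \<in> quarter_circle"
  shows "circle_norm (\<alpha>, \<beta>) =
    (if \<alpha> = 0 then \<infinity> else ereal ((1 + \<beta> - \<alpha>) / (sqrt 2 * \<alpha>)))"
proof -
  have sq: "\<alpha>\<^sup>2 + \<beta>\<^sup>2 = 1" and nn: "0 \<le> \<alpha>" "0 \<le> \<beta>"
    using assms by (auto simp: quarter_circle_def)
  obtain t where t: "0 \<le> t" "t < 2 * pi" "\<alpha> = sin t" "\<beta> = cos t"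
    using sincos_total_2pi[of \<beta> \<alpha>] sq by (metis add.commute)
  have ang: "circle_angle (\<alpha>, \<beta>) = t" using circle_angle_sin_cos t by simp
  show ?thesis
  proof (cases "\<alpha> = 0")
    case True
    then have "\<beta> = 1" using sq nn by (simp add: power2_eq_1_iff)
    then have "circle_angle (\<alpha>, \<beta>) = 0" using True circle_angle_sin_cos[of 0] by simp
    then show ?thesis using True by (simp add: circle_norm_def)
  next
    case False
    let ?s = "sin (t / 2)" and ?c = "cos (t / 2)"
    have a: "\<alpha> = 2 * ?s * ?c" using sin_double[of "t / 2"] t by simp
    have b: "1 + \<beta> = 2 * ?c\<^sup>2" using cos_double_cos[of "t / 2"] t by simp
    have "?s \<noteq> 0" "?c \<noteq> 0" using False a by auto
    then have c: "cot (t / 2) = (1 + \<beta>) / \<alpha>"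
      unfolding cot_def a b by (simp add: field_simps power2_eq_square)
    have "t \<noteq> 0" using False t by auto
    then have "circle_norm (\<alpha>, \<beta>) = ereal (1 / sqrt 2 * ((1 + \<beta>) / \<alpha> - 1))"
      unfolding circle_norm_def ang c by simp
    also have "1 / sqrt 2 * ((1 + \<beta>) / \<alpha> - 1) = (1 + \<beta> - \<alpha>) / (sqrt 2 * \<alpha>)"
      using False by (simp add: divide_simps)
    finally show ?thesis using False by simp
  qed
qed

end

theory Submission
  imports Defs
begin

text \<open>Write a point of the quarter circle as \<open>(2pq, p\<^sup>2 - q\<^sup>2) / (p\<^sup>2 + q\<^sup>2)\<close> with \<open>p = r + q\<close> and
  \<open>r, q \<ge> 0\<close>. In the homogeneous coordinates \<open>(r, q)\<close> the three inverse branches of Romik's map are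
  linear, with nonnegative integer matrices \<open>N\<^sub>1, N\<^sub>2, N\<^sub>3\<close> of determinant \<open>1, -1, 1\<close>, and the norm
  is \<open>r / (\<surd>2 q)\<close>. If \<open>N\<^bsub>d\<^sub>1\<^esub> \<cdots> N\<^bsub>d\<^sub>k\<^esub>\<close> has rows \<open>(a, b)\<close> and \<open>(c, e)\<close>, then \<open>Z\<^sub>k\<close> has coordinates
  \<open>(a, c)\<close>; since exchanging \<open>a\<close> and \<open>e\<close> is an anti-automorphism fixing each \<open>N\<^sub>i\<close>, the point \<open>P\<^sub>k''\<close>
  has coordinates \<open>(e, c)\<close>. Perron's formula is then the classical computation of
  \<open>a / c - (a w + b) / (c w + e)\<close>. Everything converges because \<open>c e \<rightarrow> \<infinity>\<close>.\<close>

subsection \<open>Homogeneous coordinates on the quarter circle\<close>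

text \<open>Squared norm of the vector \<open>(r + q, q)\<close>, whose polar angle is half the
  circle angle of the point. For nonnegative coprime integers with \<open>r\<close> odd it is the
  height.\<close>

definition radius_sq :: "real \<times> real \<Rightarrow> real" where
  "radius_sq = (\<lambda>(r, q). (r + q)\<^sup>2 + q\<^sup>2)"

definition circle_point :: "real \<times> real \<Rightarrow> real \<times> real" where
  "circle_point = (\<lambda>(r, q). (2 * (r + q) * q / radius_sq (r, q), r * (r + 2 * q) / radius_sq (r, q)))"

definition nonneg_cone :: "(real \<times> real) set" where
  "nonneg_cone = {(r, q). 0 \<le> r \<and> 0 \<le> q \<and> (r, q) \<noteq> (0, 0)}"

text \<open>The scalars are left open because the branches act both on real coordinates of points
  and on integer coordinates of convergents.\<close>

fun digit_act :: "digit \<Rightarrow> 'a::comm_semiring_1 \<times> 'a \<Rightarrow> 'a \<times> 'a" where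
  "digit_act D1 (r, q) = (r, r + q)"
| "digit_act D2 (r, q) = (r + 2 * q, r + q)"
| "digit_act D3 (r, q) = (r + 2 * q, q)"

lemma radius_sq_pos: "(r, q) \<noteq> (0, 0) \<Longrightarrow> 0 < radius_sq (r, q)"
  by (auto simp: radius_sq_def sum_power2_gt_zero_iff)

lemma nonneg_coneD: "(r, q) \<in> nonneg_cone \<Longrightarrow> 0 \<le> r \<and> 0 \<le> q \<and> 0 < r + q \<and> 0 < radius_sq (r, q)"
  using radius_sq_pos[of r q] by (auto simp: nonneg_cone_def)

lemma circle_point_in_quarter_circle:
  assumes "v \<in> nonneg_cone"
  shows "circle_point v \<in> quarter_circle"
proof -
  obtain r q where v: "v = (r, q)" by force
  have rq: "0 \<le> r" "0 \<le> q" "0 < radius_sq (r, q)"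
    using nonneg_coneD[of r q] assms v by auto
  have "(2 * (r + q) * q)\<^sup>2 + (r * (r + 2 * q))\<^sup>2 = (radius_sq (r, q))\<^sup>2"
    by (simp add: radius_sq_def power2_eq_square algebra_simps)
  then show ?thesis
    using rq by (simp add: v circle_point_def quarter_circle_def power_divide flip: add_divide_distrib)
qed

lemma circle_point_surj:
  assumes "X \<in> quarter_circle"
  obtains v where "v \<in> nonneg_cone" "X = circle_point v"
proof -
  obtain x y where X: "X = (x, y)" by force
  have xy: "x\<^sup>2 + y\<^sup>2 = 1" "0 \<le> x" "0 \<le> y"
    using assms X by (auto simp: quarter_circle_def)
  then have "x\<^sup>2 \<le> 1\<^sup>2" "y\<^sup>2 \<le> 1\<^sup>2"
    using zero_le_power2[of x] zero_le_power2[of y] unfolding one_power2 by linarith+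
  then have le: "x \<le> 1" "y \<le> 1" by (auto intro: power2_le_imp_le)
  \<comment> \<open>Half-angle formula: \<open>p : q = cot (t / 2) = (1 + y) : x\<close>, then
    \<open>r = p - q\<close>. Being free of division, the choice also covers
    \<open>(0, 1)\<close>.\<close>
  let ?v = "(1 + y - x, x)"
  have "2 * (1 + y) = radius_sq ?v"
    using xy(1) by (simp add: radius_sq_def power2_eq_square algebra_simps)
  moreover have "(1 + y - x) * (1 + y - x + 2 * x) = y * (2 * (1 + y))"
    using xy(1) by (simp add: power2_eq_square algebra_simps)
  moreover have "2 * (1 + y) \<noteq> 0" using xy by simp
  ultimately have "X = circle_point ?v"
    unfolding circle_point_def X prod.case by (simp add: field_simps)
  moreover have "?v \<in> nonneg_cone" using xy le by (auto simp: nonneg_cone_def)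
  ultimately show ?thesis using that by blast
qed

text \<open>The coordinates are homogeneous of degree 0, and cone vectors with zero cross product
  are proportional. The factor is a ratio of coordinate sums, since a single coordinate may
  vanish.\<close>

lemma circle_point_eqI:
  assumes "(r, q) \<in> nonneg_cone" "(r', q') \<in> nonneg_cone" "r * q' = q * r'"
  shows "circle_point (r, q) = circle_point (r', q')"
proof -
  define t where "t = (r' + q') / (r + q)"
  have pos: "0 < r + q" "0 < r' + q'" using assms nonneg_coneD by blast+
  then have t: "t \<noteq> 0" by (simp add: t_def)
  have r': "r' = t * r" and q': "q' = t * q"
    using assms(3) pos by (simp_all add: t_def field_simps)
  have "radius_sq (r', q') = t\<^sup>2 * radius_sq (r, q)"
    by (simp add: radius_sq_def r' q' power2_eq_square algebra_simps)
  moreover have "2 * (r' + q') * q' = t\<^sup>2 * (2 * (r + q) * q)"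
    and "r' * (r' + 2 * q') = t\<^sup>2 * (r * (r + 2 * q))"
    by (simp_all add: r' q' power2_eq_square algebra_simps)
  ultimately show ?thesis using t by (simp add: circle_point_def)
qed

section \<open>Romik's map, its digits and its inverse branches\<close>

lemma digit_act_cone: "v \<in> nonneg_cone \<Longrightarrow> digit_act x v \<in> nonneg_cone"
  by (cases v; cases x) (auto simp: nonneg_cone_def)

text \<open>Over the denominator \<open>radius_sq (r, q)\<close>, which cancels, both numerators
  factor; only the signs of \<open>r - q\<close> and \<open>r - 2 * q\<close> remain to be
  decided.\<close>

lemma romik_map_circle_point:
  assumes "(r, q) \<in> nonneg_cone"
  shows "romik_map (circle_point (r, q)) =
    (2 * q * \<bar>r - q\<bar> / ((r - q)\<^sup>2 + q\<^sup>2), r * \<bar>r - 2 * q\<bar> / ((r - q)\<^sup>2 + q\<^sup>2))"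
proof -
  let ?H = "radius_sq (r, q)" and ?x = "fst (circle_point (r, q))" and ?y = "snd (circle_point (r, q))"
  have rq: "0 \<le> r" "0 \<le> q" "0 < ?H" using nonneg_coneD assms by auto
  have H: "?H = (r + q)\<^sup>2 + q\<^sup>2" by (simp add: radius_sq_def)
  have 1: "2 - ?x - 2 * ?y = 2 * q * (q - r) / ?H"
    using rq(3) unfolding circle_point_def
    by (simp add: field_simps) (simp add: H power2_eq_square algebra_simps)
  have 2: "2 - 2 * ?x - ?y = r * (r - 2 * q) / ?H"
    using rq(3) unfolding circle_point_def
    by (simp add: field_simps) (simp add: H power2_eq_square algebra_simps)
  have 3: "3 - 2 * ?x - 2 * ?y = ((r - q)\<^sup>2 + q\<^sup>2) / ?H"
    using rq(3) unfolding circle_point_def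
    by (simp add: field_simps) (simp add: H power2_eq_square algebra_simps)
  have "romik_map (circle_point (r, q)) = romik_map (?x, ?y)" by simp
  also have "\<dots> = (\<bar>2 - ?x - 2 * ?y\<bar> / (3 - 2 * ?x - 2 * ?y), \<bar>2 - 2 * ?x - ?y\<bar> / (3 - 2 * ?x - 2 * ?y))"
    unfolding romik_map_def prod.case ..
  also have "\<dots> = (2 * q * \<bar>r - q\<bar> / ((r - q)\<^sup>2 + q\<^sup>2), r * \<bar>r - 2 * q\<bar> / ((r - q)\<^sup>2 + q\<^sup>2))"
    unfolding 1 2 3 using rq by (simp add: abs_mult abs_minus_commute)
  finally show ?thesis .
qed

text \<open>On the image of each branch the signs of \<open>s - w\<close> and
  \<open>s - 2 * w\<close> are fixed. This resolves the absolute values and returns the original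
  quadratic forms.\<close>

lemma romik_map_digit_act:
  assumes "v \<in> nonneg_cone"
  shows "romik_map (circle_point (digit_act x v)) = circle_point v"
proof -
  obtain r q where v: "v = (r, q)" by force
  have rq: "0 \<le> r" "0 \<le> q" using nonneg_coneD assms v by auto
  obtain s w where sw: "digit_act x (r, q) = (s, w)" by force
  have "(s, w) \<in> nonneg_cone" using assms v sw digit_act_cone by metis
  note romik = romik_map_circle_point[OF this]
  have "(s - w)\<^sup>2 + w\<^sup>2 = radius_sq (r, q)"
    using sw by (cases x) (auto simp: radius_sq_def power2_eq_square algebra_simps)
  moreover have "2 * w * \<bar>s - w\<bar> = 2 * (r + q) * q" "s * \<bar>s - 2 * w\<bar> = r * (r + 2 * q)"
    using sw rq by (cases x; auto simp: algebra_simps)+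
  ultimately show ?thesis unfolding v sw romik by (simp add: circle_point_def)
qed

text \<open>The abscissas 4/5 and 3/5 correspond to \<open>r = q\<close> and
  \<open>r = 2 * q\<close>; the differences from them factor with a cofactor that is positive on the
  cone.\<close>

lemma valid_digit_circle_point:
  assumes "(r, q) \<in> nonneg_cone"
  shows "valid_digit x (circle_point (r, q)) \<longleftrightarrow>
    (case x of D1 \<Rightarrow> r \<le> q | D2 \<Rightarrow> q \<le> r \<and> r \<le> 2 * q | D3 \<Rightarrow> 2 * q \<le> r)"
proof -
  let ?H = "radius_sq (r, q)" and ?x = "fst (circle_point (r, q))"
  have rq: "0 \<le> r" "0 \<le> q" "0 < r + q" "0 < ?H" using nonneg_coneD assms by auto
  have H: "?H = (r + q)\<^sup>2 + q\<^sup>2" by (simp add: radius_sq_def)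
  have x: "?x = 2 * (r + q) * q / ?H" by (simp add: circle_point_def)
  have x01: "0 \<le> ?x" "?x \<le> 1"
    using rq sum_squares_bound[of "r + q" q] by (simp_all add: x H divide_simps)
  have 45: "?x - 4 / 5 = 2 * ((2 * r + q) * (q - r)) / (5 * ?H)"
    using rq(4) unfolding x by (simp add: field_simps) (simp add: H power2_eq_square algebra_simps)
  have 35: "?x - 3 / 5 = ((3 * r + 2 * q) * (2 * q - r)) / (5 * ?H)"
    using rq(4) unfolding x by (simp add: field_simps) (simp add: H power2_eq_square algebra_simps)
  have c: "0 < 2 * r + q" "0 < 3 * r + 2 * q" using rq by linarith+
  have "0 \<le> ?x - 4 / 5 \<longleftrightarrow> r \<le> q" "?x - 4 / 5 \<le> 0 \<longleftrightarrow> q \<le> r"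
    unfolding 45 using rq(4) c by (simp_all add: zero_le_divide_iff zero_le_mult_iff divide_le_0_iff mult_le_0_iff)
  moreover have "0 \<le> ?x - 3 / 5 \<longleftrightarrow> r \<le> 2 * q" "?x - 3 / 5 \<le> 0 \<longleftrightarrow> 2 * q \<le> r"
    unfolding 35 using rq(4) c by (simp_all add: zero_le_divide_iff zero_le_mult_iff divide_le_0_iff mult_le_0_iff)
  moreover have "valid_digit x (circle_point (r, q)) \<longleftrightarrow> valid_digit x (?x, snd (circle_point (r, q)))"
    by simp
  ultimately show ?thesis using x01 by (cases x) (simp_all only: valid_digit.simps digit.case, auto)
qed

lemma valid_digit_digit_act:
  assumes "v \<in> nonneg_cone"
  shows "valid_digit x (circle_point (digit_act x v))"
proof -
  obtain r q where v: "v = (r, q)" by force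
  have "0 \<le> r" "0 \<le> q" using nonneg_coneD assms v by auto
  moreover have "digit_act x (r, q) \<in> nonneg_cone" using assms v digit_act_cone by blast
  ultimately show ?thesis by (cases x) (simp_all add: v valid_digit_circle_point)
qed

lemma valid_digit_imp_digit_act:
  assumes "v \<in> nonneg_cone" "valid_digit x (circle_point v)"
  obtains u where "u \<in> nonneg_cone" "v = digit_act x u"
proof -
  obtain r q where v: "v = (r, q)" by force
  \<comment> \<open>The inverse of each matrix; validity of the digit is exactly nonnegativity of
    both coordinates.\<close>
  let ?u = "case x of D1 \<Rightarrow> (r, q - r) | D2 \<Rightarrow> (2 * q - r, r - q) | D3 \<Rightarrow> (r - 2 * q, q)"
  have "?u \<in> nonneg_cone" "v = digit_act x ?u"
    using assms valid_digit_circle_point[of r q x] unfolding v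
    by (cases x; force simp: nonneg_cone_def)+
  then show ?thesis using that by blast
qed

subsection \<open>Products of digit matrices\<close>

text \<open>\<open>(row_left x y d k, row_right x y d k)\<close> is the row vector \<open>(x, y)\<close> times
  \<open>N\<^bsub>d 0\<^esub> \<cdots> N\<^bsub>d (k - 1)\<^esub>\<close>.\<close>

fun row_left row_right :: "int \<Rightarrow> int \<Rightarrow> (nat \<Rightarrow> digit) \<Rightarrow> nat \<Rightarrow> int" where
  "row_left x y d 0 = x"
| "row_right x y d 0 = y"
| "row_left x y d (Suc k) =
    (case d k of D3 \<Rightarrow> row_left x y d k | _ \<Rightarrow> row_left x y d k + row_right x y d k)"
| "row_right x y d (Suc k) =
    (case d k of D1 \<Rightarrow> row_right x y d k | _ \<Rightarrow> 2 * row_left x y d k + row_right x y d k)"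

abbreviation "entry11 \<equiv> row_left 1 0"
abbreviation "entry12 \<equiv> row_right 1 0"
abbreviation "entry21 \<equiv> row_left 0 1"
abbreviation "entry22 \<equiv> row_right 0 1"

definition prod_act :: "(nat \<Rightarrow> digit) \<Rightarrow> nat \<Rightarrow> 'a::comm_ring_1 \<times> 'a \<Rightarrow> 'a \<times> 'a" where
  "prod_act d k = (\<lambda>(r, q). (of_int (entry11 d k) * r + of_int (entry12 d k) * q,
     of_int (entry21 d k) * r + of_int (entry22 d k) * q))"

lemma prod_act_0: "prod_act d 0 v = v"
  by (cases v) (simp add: prod_act_def)

lemma prod_act_Suc: "prod_act d (Suc k) v = prod_act d k (digit_act (d k) v)"
  by (cases v; cases "d k") (simp_all add: prod_act_def algebra_simps)

lemma entries_det: "\<bar>entry11 d k * entry22 d k - entry12 d k * entry21 d k\<bar> = 1"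
proof (induction k)
  case (Suc k)
  have "entry11 d (Suc k) * entry22 d (Suc k) - entry12 d (Suc k) * entry21 d (Suc k) =
    (if d k = D2 then -1 else 1) * (entry11 d k * entry22 d k - entry12 d k * entry21 d k)"
    by (cases "d k") (simp_all add: algebra_simps)
  then show ?case using Suc by (auto simp: abs_mult)
qed simp

lemma entries_nonneg:
  "1 \<le> entry11 d k \<and> 0 \<le> entry12 d k \<and> 0 \<le> entry21 d k \<and> 1 \<le> entry22 d k"
  by (induction k) (auto split: digit.split)

text \<open>Modulo 2 every digit matrix is lower unitriangular. The odd entry later makes the
  integer triple of a convergent primitive.\<close>

lemma entries_parity: "even (entry12 d k) \<and> odd (entry11 d k)"
  by (induction k) (auto split: digit.split)

lemma entry21_mono: "k \<le> l \<Longrightarrow> entry21 d k \<le> entry21 d l"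
  by (rule lift_Suc_mono_le[of "entry21 d"])
    (use entries_nonneg[of d] in \<open>auto split: digit.split simp: order_trans[OF zero_le_one]\<close>)

text \<open>Any digit other than \<open>D3\<close> would add \<open>entry22\<close> \<ge> 1 to the
  lower left entry, so the product is a power of the third matrix.\<close>

lemma entry21_zero:
  assumes "\<And>k. entry21 d k = 0"
  shows "entry11 d k = 1 \<and> entry12 d k = 2 * int k \<and> entry22 d k = 1"
proof (induction k)
  case (Suc k)
  have "d k = D3"
    using assms[of "Suc k"] assms[of k] entries_nonneg[of d k] by (cases "d k") auto
  then show ?case using Suc assms[of k] by simp
qed simp

text \<open>Once \<open>entry21\<close> is positive, each further digit adds at least
  \<open>entry21\<close> squared or \<open>entry22\<close> squared to the product.\<close>

lemma entry_product_ge: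
  assumes "0 < entry21 d m"
  shows "int n \<le> entry21 d (m + n) * entry22 d (m + n)"
proof (induction n)
  case (Suc n)
  let ?c = "entry21 d (m + n)" and ?e = "entry22 d (m + n)"
  have c: "1 \<le> ?c" using assms entry21_mono[of m "m + n" d] by simp
  have e: "1 \<le> ?e" using entries_nonneg by blast
  have "1 * 1 \<le> ?c * ?c" "1 * 1 \<le> ?e * ?e" "0 \<le> ?c * ?e"
    using c e by (auto intro!: mult_mono simp del: mult_1 mult_1_right)
  then have "?c * ?e + 1 \<le> entry21 d (m + Suc n) * entry22 d (m + Suc n)"
    by (cases "d (m + n)") (simp_all add: algebra_simps)
  then show ?case using Suc by simp
qed (use entries_nonneg[of d m] in simp)

lemma entry_product_tendsto:
  assumes "0 < entry21 d m"
  shows "(\<lambda>k. 1 / real_of_int (entry21 d k * entry22 d k)) \<longlonglongrightarrow> 0"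
proof -
  have "(\<lambda>n. 1 / real_of_int (entry21 d (n + m) * entry22 d (n + m))) \<longlonglongrightarrow> 0"
  proof (rule tendsto_divide_0[OF tendsto_const], rule filterlim_at_top_imp_at_infinity,
      rule filterlim_at_top_mono[OF filterlim_real_sequentially])
    show "\<forall>\<^sub>F n in sequentially. real n \<le> real_of_int (entry21 d (n + m) * entry22 d (n + m))"
      using entry_product_ge[OF assms]
      by (intro always_eventually allI) (metis add.commute of_int_le_iff of_int_of_nat_eq)
  qed
  then show ?thesis by (rule LIMSEQ_offset)
qed

subsection \<open>Digit expansions\<close>

lemma is_expansion_digit_act:
  assumes "is_expansion d (circle_point v)" "v \<in> nonneg_cone"
  shows "is_expansion (case_nat x d) (circle_point (digit_act x v))"
proof -
  have "valid_digit (case_nat x d j) ((romik_map ^^ j) (circle_point (digit_act x v)))" for j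
  proof (cases j)
    case 0
    then show ?thesis using assms(2) valid_digit_digit_act by simp
  next
    case (Suc n)
    then show ?thesis
      using assms by (simp add: funpow_Suc_right romik_map_digit_act is_expansion_def del: funpow.simps)
  qed
  then show ?thesis
    using assms(2) digit_act_cone circle_point_in_quarter_circle unfolding is_expansion_def by blast
qed

text \<open>Each valid digit peels off one inverse branch. The equation for \<open>v\<close> is
  exact, not merely up to scaling, so determinants can be compared.\<close>

lemma expansion_prod_act:
  assumes "is_expansion d (circle_point v)" "v \<in> nonneg_cone"
  obtains u where "u \<in> nonneg_cone" "v = prod_act d k u" "(romik_map ^^ k) (circle_point v) = circle_point u"
proof -
  have "\<exists>u \<in> nonneg_cone. v = prod_act d k u \<and> (romik_map ^^ k) (circle_point v) = circle_point u"
  proof (induction k)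
    case 0
    show ?case using assms(2) by (auto simp: prod_act_0)
  next
    case (Suc k)
    then obtain u where u: "u \<in> nonneg_cone" "v = prod_act d k u"
      "(romik_map ^^ k) (circle_point v) = circle_point u" by blast
    then have "valid_digit (d k) (circle_point u)"
      using assms(1) unfolding is_expansion_def by metis
    then obtain u' where "u' \<in> nonneg_cone" "u = digit_act (d k) u'"
      using u(1) valid_digit_imp_digit_act by blast
    then show ?case using u by (auto simp: prod_act_Suc romik_map_digit_act intro!: bexI[of _ u'])
  qed
  then show ?thesis using that by blast
qed

section \<open>Uniqueness of digit expansions\<close>

lemma cross_prod_act:
  fixes v u :: "real \<times> real"
  shows "\<bar>fst (prod_act d k v) * snd (prod_act d k u) - snd (prod_act d k v) * fst (prod_act d k u)\<bar>
    = \<bar>fst v * snd u - snd v * fst u\<bar>"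
proof -
  \<comment> \<open>A linear map multiplies the cross product by its determinant, here 1 or
    -1.\<close>
  let ?D = "real_of_int (entry11 d k * entry22 d k - entry12 d k * entry21 d k)"
  have "fst (prod_act d k v) * snd (prod_act d k u) - snd (prod_act d k v) * fst (prod_act d k u)
    = ?D * (fst v * snd u - snd v * fst u)"
    by (simp add: prod_act_def split_beta algebra_simps)
  moreover have "\<bar>?D\<bar> = 1" using entries_det[of d k] by (metis of_int_1 of_int_abs)
  ultimately show ?thesis by (simp add: abs_mult)
qed

text \<open>Peeling off \<open>k\<close> digits \<open>D3\<close> leaves the nonnegative coordinate
  \<open>fst v - 2 * k * snd v\<close>, impossible for all \<open>k\<close> if \<open>snd v\<close>
  is positive.\<close>

lemma expansion_entry21_zero:
  assumes "is_expansion d (circle_point v)" "v \<in> nonneg_cone" "\<And>k. entry21 d k = 0"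
  shows "snd v = 0"
proof (rule ccontr)
  assume "snd v \<noteq> 0"
  then have pos: "0 < snd v" using assms(2) by (auto simp: nonneg_cone_def)
  obtain k where k: "fst v / snd v < real k" using reals_Archimedean2 by blast
  obtain u where u: "u \<in> nonneg_cone" "v = prod_act d k u"
    using expansion_prod_act[OF assms(1,2)] by blast
  have "fst v = fst u + 2 * (real k * snd v)" "snd v = snd u"
    using entry21_zero[OF assms(3)] assms(3)[of k] by (simp_all add: u(2) prod_act_def split_beta)
  moreover have "0 \<le> fst u" using u(1) by (auto simp: nonneg_cone_def)
  moreover have "0 \<le> real k * snd v" using pos by simp
  moreover have "fst v < real k * snd v" using k pos by (simp add: field_simps)
  ultimately show False by linarith
qed

text \<open>Peeling common digits off both points preserves their cross product up to sign, yet
  bounds it by a constant over \<open>c * e\<close>, which tends to 0. If \<open>c\<close> stays 0,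
  both points are \<open>(0, 1)\<close>.\<close>

lemma expansion_unique:
  assumes "is_expansion d X" "is_expansion d Y"
  shows "X = Y"
proof -
  obtain v u where v: "v \<in> nonneg_cone" "X = circle_point v" and u: "u \<in> nonneg_cone" "Y = circle_point u"
    using assms circle_point_surj unfolding is_expansion_def by metis
  note ev = assms(1)[unfolded v(2)] and eu = assms(2)[unfolded u(2)]
  let ?x = "\<bar>fst v * snd u - snd v * fst u\<bar>"
  have "?x = 0"
  proof (cases "\<forall>k. entry21 d k = 0")
    case True
    then show ?thesis
      using expansion_entry21_zero[OF ev v(1)] expansion_entry21_zero[OF eu u(1)] by simp
  next
    case False
    then obtain m where "entry21 d m \<noteq> 0" by blast
    then have m: "0 < entry21 d m" using entries_nonneg[of d m] by linarith
    have "?x \<le> snd v * snd u * (1 / real_of_int (entry21 d k * entry22 d k))" if "m \<le> k" for k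
    proof -
      define c e where "c = real_of_int (entry21 d k)" and "e = real_of_int (entry22 d k)"
      have pos: "0 < c" "0 < e"
        using entry21_mono[OF that, of d] m entries_nonneg[of d k] unfolding c_def e_def by simp_all
      obtain v' where v': "v' \<in> nonneg_cone" "v = prod_act d k v'"
        using expansion_prod_act[OF ev v(1)] by blast
      obtain u' where u': "u' \<in> nonneg_cone" "u = prod_act d k u'"
        using expansion_prod_act[OF eu u(1)] by blast
      have nn: "0 \<le> fst v'" "0 \<le> snd v'" "0 \<le> fst u'" "0 \<le> snd u'"
        using v' u' by (auto simp: nonneg_cone_def)
      have "?x = \<bar>fst v' * snd u' - snd v' * fst u'\<bar>"
        unfolding v'(2) u'(2) by (rule cross_prod_act)
      also have "\<dots> \<le> fst v' * snd u' + snd v' * fst u'"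
        using nn mult_nonneg_nonneg[of "fst v'" "snd u'"] mult_nonneg_nonneg[of "snd v'" "fst u'"] by linarith
      finally have "c * e * ?x \<le> c * e * (fst v' * snd u' + snd v' * fst u')"
        using pos by simp
      \<comment> \<open>The left side consists of the mixed terms of the product on the right; the
        remaining terms are nonnegative.\<close>
      also have "\<dots> \<le> (c * fst v' + e * snd v') * (c * fst u' + e * snd u')"
      proof -
        have "0 \<le> (c * c) * (fst v' * fst u') + (e * e) * (snd v' * snd u')"
          using pos nn by (intro add_nonneg_nonneg mult_nonneg_nonneg) simp_all
        then show ?thesis by (simp add: algebra_simps)
      qed
      also have "\<dots> = snd v * snd u"
        by (simp add: v'(2) u'(2) prod_act_def split_beta c_def e_def)
      finally show ?thesis using pos by (simp add: c_def[symmetric] e_def[symmetric] field_simps)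
    qed
    moreover have "(\<lambda>k. snd v * snd u * (1 / real_of_int (entry21 d k * entry22 d k))) \<longlonglongrightarrow> snd v * snd u * 0"
      using entry_product_tendsto[OF m] by (intro tendsto_mult tendsto_const)
    ultimately have "?x \<le> snd v * snd u * 0"
      using LIMSEQ_le_const by blast
    then show ?thesis by simp
  qed
  then show ?thesis
    using circle_point_eqI[of "fst v" "snd v" "fst u" "snd u"] v u by simp
qed

section \<open>The tail and reversed points\<close>

lemma point_of_eqI: "is_expansion d X \<Longrightarrow> point_of d = X"
  unfolding point_of_def using expansion_unique by blast

lemma tail_point_eq: "is_expansion d X \<Longrightarrow> tail_point d k = (romik_map ^^ k) X"
  unfolding tail_point_def
proof (rule point_of_eqI)
  assume X: "is_expansion d X"
  then obtain v where v: "v \<in> nonneg_cone" "X = circle_point v"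
    using circle_point_surj unfolding is_expansion_def by metis
  then have "(romik_map ^^ k) X \<in> quarter_circle"
    using expansion_prod_act[of d v k] X circle_point_in_quarter_circle by metis
  then show "is_expansion (\<lambda>j. d (k + j)) ((romik_map ^^ k) X)"
    using X unfolding is_expansion_def by (metis add.commute comp_apply funpow_add)
qed

text \<open>Appending \<open>d k\<close> to the product prepends it to the reversed digits: the
  bottom row, read backwards, changes by \<open>digit_act (d k)\<close>. The induction starts at
  \<open>(1, 0)\<close>, the fixed point \<open>(0, 1)\<close> with all digits
  \<open>D3\<close>.\<close>

lemma reversed_point_eq:
  "reversed_point d k = circle_point (real_of_int (entry22 d k), real_of_int (entry21 d k))"
  unfolding reversed_point_def
proof (rule point_of_eqI, induction k)
  case 0
  have 1: "(1, 0) \<in> nonneg_cone" by (simp add: nonneg_cone_def)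
  have "romik_map (circle_point (1, 0)) = circle_point (1, 0)"
    using romik_map_digit_act[OF 1, of D3] by simp
  then have "(romik_map ^^ j) (circle_point (1, 0)) = circle_point (1, 0)" for j
    by (induction j) simp_all
  then show ?case
    using 1 circle_point_in_quarter_circle valid_digit_digit_act[OF 1, of D3]
    by (simp add: is_expansion_def)
next
  case (Suc k)
  let ?v = "(real_of_int (entry22 d k), real_of_int (entry21 d k))"
  have "?v \<in> nonneg_cone" using entries_nonneg[of d k] by (simp add: nonneg_cone_def)
  from is_expansion_digit_act[OF Suc this, of "d k"]
  have "is_expansion (case_nat (d k) (\<lambda>j. if j < k then d (k - 1 - j) else D3))
    (circle_point (digit_act (d k) ?v))" .
  moreover have "case_nat (d k) (\<lambda>j. if j < k then d (k - 1 - j) else D3) =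
    (\<lambda>j. if j < Suc k then d (Suc k - 1 - j) else D3)"
    by (auto simp: fun_eq_iff split: nat.split)
  moreover have "digit_act (d k) ?v = (real_of_int (entry22 d (Suc k)), real_of_int (entry21 d (Suc k)))"
    by (cases "d k") simp_all
  ultimately show ?case by simp
qed

subsection \<open>Convergents and heights\<close>

definition int_vec :: "int \<times> int \<Rightarrow> int^3" where
  "int_vec = (\<lambda>(r, q). vector [2 * (r + q) * q, r * (r + 2 * q), (r + q)\<^sup>2 + q\<^sup>2])"

text \<open>The entries of \<open>int_vec\<close> form a basis of the quadratic forms in
  \<open>(r, q)\<close>; the 3x3 matrix is the symmetric square of the 2x2 one in this
  basis.\<close>

lemma digit_matrix_int_vec: "digit_matrix x *v int_vec v = int_vec (digit_act x v)"
  by (cases v; cases x)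
    (simp_all add: int_vec_def vec_eq_iff forall_3 matrix_vector_mult_def sum_3 power2_eq_square algebra_simps)

lemma digit_matrix_prod_int_vec: "digit_matrix_prod d k *v int_vec v = int_vec (prod_act d k v)"
  by (induction k arbitrary: v)
    (simp_all add: prod_act_0 prod_act_Suc digit_matrix_int_vec flip: matrix_vector_mul_assoc)

lemma convergent01_eq:
  "convergent01 d k = circle_point (real_of_int (entry11 d k), real_of_int (entry21 d k))"
proof -
  have "vector [0, 1, 1] = int_vec (1, 0)" by (simp add: int_vec_def)
  then have "digit_matrix_prod d k *v vector [0, 1, 1] = int_vec (entry11 d k, entry21 d k)"
    using digit_matrix_prod_int_vec[of d k "(1, 0)"] by (simp add: prod_act_def)
  then show ?thesis
    by (simp add: convergent01_def int_vec_def circle_point_def radius_sq_def)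
qed

lemma rat_height_eqI:
  assumes "0 < c" "Gcd {a, b, c} = 1"
  shows "rat_height (real_of_int a / real_of_int c, real_of_int b / real_of_int c) = c"
proof -
  \<comment> \<open>\<open>c\<close> divides \<open>c'\<close> times each of \<open>a\<close>,
    \<open>b\<close>, \<open>c\<close>, hence \<open>c'\<close> times their gcd 1. Generality in all
    variables lets the roles be swapped below.\<close>
  have dvd: "c \<le> c'" if "0 < c" "0 < c'" "Gcd {a, b, c} = 1"
    "real_of_int a / real_of_int c = real_of_int a' / real_of_int c'"
    "real_of_int b / real_of_int c = real_of_int b' / real_of_int c'" for a b c a' b' c' :: int
  proof -
    have "real_of_int (a * c') = real_of_int (a' * c)" "real_of_int (b * c') = real_of_int (b' * c)"
      using that by (simp_all add: field_simps)
    then have "a * c' = a' * c" "b * c' = b' * c" by linarith+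
    then have "c dvd a * c'" "c dvd b * c'" "c dvd c * c'" by simp_all
    then have "c dvd gcd (a * c') (gcd (b * c') (c * c'))" by simp
    also have "\<dots> = gcd a (gcd b c) * c'"
      using gcd_mult_distrib_int[of c' b c] gcd_mult_distrib_int[of c' a "gcd b c"] that(2)
      by (simp add: mult.commute)
    also have "gcd a (gcd b c) = 1" using that(3) by simp
    finally show ?thesis using that by (simp add: zdvd_imp_le)
  qed
  show ?thesis
    unfolding rat_height_def
  proof (rule the_equality)
    fix c' :: int
    assume "0 < c' \<and> (\<exists>a' b'. Gcd {a', b', c'} = 1 \<and>
      (real_of_int a / real_of_int c, real_of_int b / real_of_int c) =
      (real_of_int a' / real_of_int c', real_of_int b' / real_of_int c'))"
    then obtain a' b' where "0 < c'" "Gcd {a', b', c'} = 1"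
      "real_of_int a / real_of_int c = real_of_int a' / real_of_int c'"
      "real_of_int b / real_of_int c = real_of_int b' / real_of_int c'"
      unfolding prod.inject by blast
    then show "c' = c" using assms dvd[of c c' a b a' b'] dvd[of c' c a' b' a b] by simp
  qed (use assms in blast)
qed

text \<open>The second entry is odd, so the gcd is odd. Sum and difference of the last two entries
  are twice the coprime squares of \<open>r + q\<close> and \<open>q\<close>, so it divides
  both.\<close>

lemma Gcd_pythagorean_triple:
  fixes r q :: int
  assumes "coprime r q" "odd r"
  shows "Gcd {2 * (r + q) * q, r * (r + 2 * q), (r + q)\<^sup>2 + q\<^sup>2} = 1"
proof -
  let ?g = "Gcd {2 * (r + q) * q, r * (r + 2 * q), (r + q)\<^sup>2 + q\<^sup>2}"
  have d: "?g dvd r * (r + 2 * q)" "?g dvd (r + q)\<^sup>2 + q\<^sup>2" by (rule Gcd_dvd; simp)+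
  have "odd (r * (r + 2 * q))" using assms(2) by simp
  then have "odd ?g" using d(1) dvd_trans by blast
  then have odd: "coprime ?g 2" by simp
  have "(r + q)\<^sup>2 + q\<^sup>2 - r * (r + 2 * q) = 2 * q\<^sup>2" "(r + q)\<^sup>2 + q\<^sup>2 + r * (r + 2 * q) = 2 * (r + q)\<^sup>2"
    by (simp_all add: power2_eq_square algebra_simps)
  then have "?g dvd 2 * q\<^sup>2" "?g dvd 2 * (r + q)\<^sup>2" using d by (metis dvd_diff, metis dvd_add)
  then have "?g dvd q\<^sup>2" "?g dvd (r + q)\<^sup>2" using odd coprime_dvd_mult_right_iff by blast+
  moreover have "coprime ((r + q)\<^sup>2) (q\<^sup>2)"
    using assms(1) by (simp add: coprime_iff_gcd_eq_1)
  ultimately have "is_unit ?g" using coprime_common_divisor by blast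
  then show ?thesis by simp
qed

lemma rat_height_convergent01:
  "real_of_int (rat_height (convergent01 d k)) =
    radius_sq (real_of_int (entry11 d k), real_of_int (entry21 d k))"
proof -
  let ?a = "entry11 d k" and ?c = "entry21 d k"
  have "coprime ?a ?c"
  proof (rule coprimeI)
    fix g assume "g dvd ?a" "g dvd ?c"
    then have "g dvd \<bar>?a * entry22 d k - entry12 d k * ?c\<bar>" by simp
    then show "is_unit g" by (simp only: entries_det)
  qed
  then have "Gcd {2 * (?a + ?c) * ?c, ?a * (?a + 2 * ?c), (?a + ?c)\<^sup>2 + ?c\<^sup>2} = 1"
    using entries_parity Gcd_pythagorean_triple by blast
  moreover have "0 < (?a + ?c)\<^sup>2 + ?c\<^sup>2"
    using entries_nonneg[of d k] by (simp add: sum_power2_gt_zero_iff)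
  ultimately have "rat_height (real_of_int (2 * (?a + ?c) * ?c) / real_of_int ((?a + ?c)\<^sup>2 + ?c\<^sup>2),
      real_of_int (?a * (?a + 2 * ?c)) / real_of_int ((?a + ?c)\<^sup>2 + ?c\<^sup>2)) = (?a + ?c)\<^sup>2 + ?c\<^sup>2"
    by (intro rat_height_eqI)
  then show ?thesis by (simp add: convergent01_eq circle_point_def radius_sq_def)
qed

subsection \<open>Distances, angles and norms\<close>

text \<open>A chord is twice the sine of half the angle difference, that is, of the angle between
  the vectors \<open>(r + q, q)\<close> and \<open>(r' + q', q')\<close>.\<close>

lemma dist_circle_point:
  assumes "(r, q) \<in> nonneg_cone" "(r', q') \<in> nonneg_cone"
  shows "dist (circle_point (r, q)) (circle_point (r', q')) =
    2 * \<bar>r * q' - q * r'\<bar> / (sqrt (radius_sq (r, q)) * sqrt (radius_sq (r', q')))"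
proof -
  let ?H = "radius_sq (r, q)" and ?H' = "radius_sq (r', q')"
  have H: "0 < ?H" "0 < ?H'" using assms nonneg_coneD by blast+
  have "(2 * (r + q) * q / ?H - 2 * (r' + q') * q' / ?H')\<^sup>2 +
      (r * (r + 2 * q) / ?H - r' * (r' + 2 * q') / ?H')\<^sup>2
    = ((2 * (r + q) * q * ?H' - 2 * (r' + q') * q' * ?H)\<^sup>2 +
      (r * (r + 2 * q) * ?H' - r' * (r' + 2 * q') * ?H)\<^sup>2) / (?H * ?H')\<^sup>2"
    using H by (simp add: diff_frac_eq power_divide add_divide_distrib)
  also have "(2 * (r + q) * q * ?H' - 2 * (r' + q') * q' * ?H)\<^sup>2 +
      (r * (r + 2 * q) * ?H' - r' * (r' + 2 * q') * ?H)\<^sup>2 = (2 * (r * q' - q * r'))\<^sup>2 * (?H * ?H')"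
    unfolding radius_sq_def prod.case by algebra
  also have "\<dots> / (?H * ?H')\<^sup>2 = (2 * (r * q' - q * r'))\<^sup>2 / (?H * ?H')"
    using H by (simp add: power2_eq_square)
  finally show ?thesis
    by (simp only: circle_point_def prod.case dist_prod_def fst_conv snd_conv dist_real_def power2_abs
        real_sqrt_divide real_sqrt_mult real_sqrt_abs abs_mult abs_numeral)
qed

lemma sin_half_circle_angle:
  assumes "(r, q) \<in> nonneg_cone"
  shows "sin (circle_angle (circle_point (r, q)) / 2) = q / sqrt (radius_sq (r, q))"
proof -
  let ?H = "radius_sq (r, q)"
  have rq: "0 \<le> q" "0 < ?H" using assms nonneg_coneD by blast+
  define X where "X = circle_point (r, q)"
  have "(snd X)\<^sup>2 + (fst X)\<^sup>2 = 1"
    using circle_point_in_quarter_circle[OF assms] by (auto simp: X_def quarter_circle_def)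
  then obtain t where t: "0 \<le> t" "t < 2 * pi" "snd X = cos t" "fst X = sin t"
    using sincos_total_2pi by metis
  then have ang: "circle_angle X = t" using circle_angle_sin_cos[of t] by (metis prod.collapse)
  have "(sin (t / 2))\<^sup>2 = (1 - snd X) / 2" using cos_double_sin[of "t / 2"] t by simp
  also have "\<dots> = q\<^sup>2 / ?H"
    using rq(2) by (simp add: X_def circle_point_def divide_simps)
      (simp add: radius_sq_def power2_eq_square algebra_simps)
  also have "\<dots> = (q / sqrt ?H)\<^sup>2" using rq by (simp add: power_divide)
  finally have "(sin (t / 2))\<^sup>2 = (q / sqrt ?H)\<^sup>2" .
  moreover have "0 \<le> sin (t / 2)" using t by (intro sin_ge_zero) simp_all
  ultimately show ?thesis
    using rq unfolding X_def[symmetric] ang by (auto intro: power2_eq_imp_eq)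
qed

text \<open>Here \<open>cot (t / 2) - 1 = (r + q) / q - 1 = r / q\<close>; positivity of
  \<open>q\<close> excludes \<open>(0, 1)\<close>, where the norm is infinite.\<close>

lemma circle_norm_circle_point:
  assumes "(r, q) \<in> nonneg_cone" "0 < q"
  shows "circle_norm (circle_point (r, q)) = ereal (r / (sqrt 2 * q))"
proof -
  let ?H = "radius_sq (r, q)" and ?\<alpha> = "fst (circle_point (r, q))" and ?\<beta> = "snd (circle_point (r, q))"
  have rq: "0 < r + q" "0 < ?H" using assms nonneg_coneD by blast+
  have \<alpha>: "?\<alpha> = 2 * (r + q) * q / ?H" by (simp add: circle_point_def)
  have "1 + ?\<beta> - ?\<alpha> = 2 * (r + q) * r / ?H"
    using rq(2) by (simp add: circle_point_def divide_simps)
      (simp add: radius_sq_def power2_eq_square algebra_simps)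
  then have "(1 + ?\<beta> - ?\<alpha>) / (sqrt 2 * ?\<alpha>) = r / (sqrt 2 * q)"
    using rq assms(2) by (simp add: \<alpha> divide_simps)
  moreover have "?\<alpha> \<noteq> 0" using rq assms(2) by (simp add: \<alpha>)
  ultimately show ?thesis
    using circle_norm_eq[of ?\<alpha> ?\<beta>] circle_point_in_quarter_circle[OF assms(1)] by simp
qed

subsection \<open>Perron's formula\<close>

lemma rat_circle_point:
  "circle_point (real_of_int a, real_of_int c) \<in> \<rat> \<times> \<rat>"
  by (simp add: circle_point_def radius_sq_def)

theorem theorem2p14:
  fixes P :: "real \<times> real" and d :: "nat \<Rightarrow> digit"
  assumes "P \<in> quarter_circle" and "P \<notin> \<rat> \<times> \<rat>" and "is_expansion d P"
  shows "(\<forall>\<^sub>F k in sequentially.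
            ereal (approx_delta P (convergent01 d k)) =
              ereal (sqrt 2) / (circle_norm (tail_point d k) + circle_norm (reversed_point d k))
                * ereal (perron_eps P d k))
         \<and> (\<lambda>k. perron_eps P d k) \<longlonglongrightarrow> 1"
proof -
  obtain p1 p2 where p: "(p1, p2) \<in> nonneg_cone" and P: "P = circle_point (p1, p2)"
    using circle_point_surj[OF assms(1)] by (metis surj_pair)
  define a b c e where "a k = real_of_int (entry11 d k)" and "b k = real_of_int (entry12 d k)"
    and "c k = real_of_int (entry21 d k)" and "e k = real_of_int (entry22 d k)" for k
  note exp = assms(3)[unfolded P]
  have p2: "0 < p2"
  proof -
    have "p2 \<noteq> 0"
    proof
      assume "p2 = 0"
      then have "P = circle_point (real_of_int 1, real_of_int 0)"
        unfolding P using p by (intro circle_point_eqI) (simp_all add: nonneg_cone_def)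
      then show False using rat_circle_point assms(2) by metis
    qed
    then show ?thesis using p nonneg_coneD by fastforce
  qed
  \<comment> \<open>From this index on \<open>c k\<close> is positive, so the norm of the reversed
    point is finite.\<close>
  then obtain m where m: "entry21 d m \<noteq> 0"
    using expansion_entry21_zero[OF exp p] by auto
  then have m: "0 < entry21 d m" using entries_nonneg[of d m] by linarith
  have c: "0 < c k" if "m \<le> k" for k using entry21_mono[OF that, of d] m by (simp add: c_def)
  have e: "0 < e k" and a: "0 < a k" and nn: "0 \<le> b k" "0 \<le> c k" for k
    using entries_nonneg[of d k] by (simp_all add: a_def b_def c_def e_def)
  have Zcone: "(a k, c k) \<in> nonneg_cone" and Rcone: "(e k, c k) \<in> nonneg_cone" for k
    using a[of k] e[of k] nn[of k] by (simp_all add: nonneg_cone_def)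
  have Z: "convergent01 d k = circle_point (a k, c k)" for k
    by (simp add: convergent01_eq a_def c_def)
  have eps: "perron_eps P d k =
      (p2 / sqrt (radius_sq (p1, p2))) / (c k / sqrt (radius_sq (a k, c k)))" for k
    unfolding perron_eps_def Z P using sin_half_circle_angle p Zcone by simp

  have tail: "\<exists>r q. (r, q) \<in> nonneg_cone \<and> 0 < q \<and> tail_point d k = circle_point (r, q) \<and>
      p1 = a k * r + b k * q \<and> p2 = c k * r + e k * q" for k
  proof -
    obtain r q where rq: "(r, q) \<in> nonneg_cone" "(p1, p2) = prod_act d k (r, q)"
      "(romik_map ^^ k) P = circle_point (r, q)"
      using expansion_prod_act[OF exp p] P by (metis surj_pair)
    then have eqs: "p1 = a k * r + b k * q" "p2 = c k * r + e k * q"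
      by (simp_all add: prod_act_def a_def b_def c_def e_def)
    \<comment> \<open>Otherwise \<open>(p1, p2)\<close> is a multiple of the first column and
      \<open>P\<close> equals a rational convergent.\<close>
    have "q \<noteq> 0"
    proof
      assume "q = 0"
      then have "P = circle_point (a k, c k)"
        unfolding P using eqs by (intro circle_point_eqI p Zcone) simp
      then show False using rat_circle_point assms(2) unfolding a_def c_def by metis
    qed
    moreover have "0 \<le> q" using rq(1) by (simp add: nonneg_cone_def)
    ultimately show ?thesis
      using rq eqs tail_point_eq[OF assms(3)] by (intro exI[of _ r] exI[of _ q]) simp
  qed
  \<comment> \<open>The convergent is the image of \<open>(1, 0)\<close>, so its cross product with
    \<open>P\<close> is, up to sign, that of \<open>(1, 0)\<close> with
    \<open>(r, q)\<close>.\<close>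
  have cross: "\<bar>p1 * c k - p2 * a k\<bar> = q"
    if "0 < q" "p1 = a k * r + b k * q" "p2 = c k * r + e k * q" for k r q
    using cross_prod_act[of d k "(r, q)" "(1, 0)"] that
    by (simp add: prod_act_def a_def b_def c_def e_def)

  have "ereal (approx_delta P (convergent01 d k)) =
      ereal (sqrt 2) / (circle_norm (tail_point d k) + circle_norm (reversed_point d k))
        * ereal (perron_eps P d k)" if k: "m \<le> k" for k
  proof -
    let ?hZ = "sqrt (radius_sq (a k, c k))" and ?hP = "sqrt (radius_sq (p1, p2))"
    have h: "0 < ?hZ" "0 < ?hP" using nonneg_coneD Zcone p by simp_all
    obtain r q where rq: "(r, q) \<in> nonneg_cone" "0 < q" "tail_point d k = circle_point (r, q)"
      "p1 = a k * r + b k * q" "p2 = c k * r + e k * q"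
      using tail by blast
    have "approx_delta P (convergent01 d k) = radius_sq (a k, c k) * (2 * q / (?hP * ?hZ))"
      unfolding approx_delta_def
      using rat_height_convergent01[of d k] dist_circle_point[OF p Zcone, of k] cross[OF rq(2,4,5)]
      by (simp add: a_def c_def P Z)
    also have "\<dots> = 2 * q * (radius_sq (a k, c k) / ?hZ) / ?hP" by (simp add: mult.commute)
    also have "radius_sq (a k, c k) / ?hZ = ?hZ" using h by (intro real_div_sqrt) simp
    finally have lhs: "approx_delta P (convergent01 d k) = 2 * q * ?hZ / ?hP" .
    have n: "circle_norm (tail_point d k) + circle_norm (reversed_point d k)
        = ereal (r / (sqrt 2 * q) + e k / (sqrt 2 * c k))"
      using circle_norm_circle_point[OF rq(1,2)] circle_norm_circle_point[OF Rcone c[OF k]]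
      by (simp add: rq(3) reversed_point_eq c_def e_def)
    \<comment> \<open>Over the common denominator the numerator is
      \<open>c k * r + e k * q = p2\<close>, which links the two norms to \<open>P\<close>.\<close>
    have s: "r / (sqrt 2 * q) + e k / (sqrt 2 * c k) = p2 / (sqrt 2 * (q * c k))"
      using rq c[OF k] by (simp add: field_simps)
    have "sqrt 2 / (p2 / (sqrt 2 * (q * c k))) * perron_eps P d k = 2 * q * ?hZ / ?hP"
      unfolding eps using h rq(2) c[OF k] p2 by (simp add: field_simps)
    then show ?thesis
      unfolding n s lhs using p2 rq(2) c[OF k] by simp
  qed
  then have formula: "\<forall>\<^sub>F k in sequentially. ereal (approx_delta P (convergent01 d k)) =
      ereal (sqrt 2) / (circle_norm (tail_point d k) + circle_norm (reversed_point d k))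
        * ereal (perron_eps P d k)"
    by (rule eventually_sequentiallyI)

  \<comment> \<open>The error is \<open>q / (c k * p2)\<close>, and \<open>e k * q\<close> \<le>
    \<open>p2\<close> brings it below \<open>1 / (c k * e k)\<close>.\<close>
  have "(\<lambda>k. a k / c k - p1 / p2) \<longlonglongrightarrow> 0"
  proof (rule Lim_null_comparison[OF _ entry_product_tendsto[OF m]], rule eventually_sequentiallyI)
    fix k assume k: "m \<le> k"
    obtain r q where rq: "(r, q) \<in> nonneg_cone" "0 < q"
      "p1 = a k * r + b k * q" "p2 = c k * r + e k * q"
      using tail by blast
    have "a k / c k - p1 / p2 = - (p1 * c k - p2 * a k) / (c k * p2)"
      using c[OF k] p2 by (simp add: field_simps)
    then have "\<bar>a k / c k - p1 / p2\<bar> = q / (c k * p2)"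
      using cross[OF rq(2-4)] c[OF k] p2 by (simp add: abs_mult abs_divide)
    also have "\<dots> \<le> 1 / (c k * e k)"
    proof -
      have "e k * q \<le> p2" using rq c[OF k] nonneg_coneD[OF rq(1)] by simp
      then show ?thesis using c[OF k] e[of k] p2 by (simp add: field_simps)
    qed
    finally show "norm (a k / c k - p1 / p2) \<le> 1 / real_of_int (entry21 d k * entry22 d k)"
      by (simp add: c_def e_def)
  qed
  then have lim: "(\<lambda>k. a k / c k) \<longlonglongrightarrow> p1 / p2" by (simp add: LIM_zero_iff)
  \<comment> \<open>This makes \<open>perron_eps\<close> a continuous function of
    \<open>a k / c k\<close>, with value 1 at \<open>p1 / p2\<close>.\<close>
  have h: "sqrt (radius_sq (x, y)) / y = sqrt ((x / y + 1)\<^sup>2 + 1)" if "0 < y" for x y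
  proof -
    have "(x / y + 1)\<^sup>2 + 1 = radius_sq (x, y) / y\<^sup>2"
      using that by (simp add: radius_sq_def power2_eq_square field_simps)
    then show ?thesis using that by (simp add: real_sqrt_divide)
  qed
  have "(\<lambda>k. p2 / sqrt (radius_sq (p1, p2)) * sqrt ((a k / c k + 1)\<^sup>2 + 1))
      \<longlonglongrightarrow> p2 / sqrt (radius_sq (p1, p2)) * sqrt ((p1 / p2 + 1)\<^sup>2 + 1)"
    by (intro tendsto_intros lim)
  moreover have "p2 / sqrt (radius_sq (p1, p2)) * sqrt ((p1 / p2 + 1)\<^sup>2 + 1) = 1"
    using p2 nonneg_coneD[OF p] by (simp flip: h)
  moreover have "\<forall>\<^sub>F k in sequentially.
      p2 / sqrt (radius_sq (p1, p2)) * sqrt ((a k / c k + 1)\<^sup>2 + 1) = perron_eps P d k"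
  proof (rule eventually_sequentiallyI[of m])
    fix k assume k: "m \<le> k"
    show "p2 / sqrt (radius_sq (p1, p2)) * sqrt ((a k / c k + 1)\<^sup>2 + 1) = perron_eps P d k"
      unfolding eps h[OF c[OF k], symmetric] by simp
  qed
  ultimately have "(\<lambda>k. perron_eps P d k) \<longlonglongrightarrow> 1"
    by (simp only: Lim_transform_eventually)
  with formula show ?thesis by blast
qed

end
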